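(* For any pair of error measures $(\eta_0,\eta_1)$, the complexity classes form a strict hierarchy: $\mathcal{C}_1^{(\eta_0,\eta_1)}\subsetneq\mathcal{C}_2^{(\eta_0,\eta_1)}\subsetneq\mathcal{C}_3^{(\eta_0,\eta_1)}\subsetneq\cdots\subsetneq\mathcal{C}_\infty^{(\eta_0,\eta_1)}$.
   Context: Setting: online minimization problems with binary predictions; an instance is $I=(x,\hat x,r)$ with request sequence $r$, $x\in\{0,1\}^n$ encoding an optimal solution, $\hat x\in\{0,1\}^n$ its prediction, $\hat x_i$ revealed with $r_i$. An error measure maps instances to $[0,\infty)$. A deterministic online algorithm is $(\alpha,\beta,\gamma)$-competitive w.r.t. $(\eta_0,\eta_1)$ if there is a constant $\kappa$ with $\mathrm{Alg}(I)\le\alpha\,\mathrm{Opt}(I)+\beta\,\eta_0(I)+\gamma\,\eta_1(I)+\kappa$ for all $I$. $Q$ is as hard as $P$ (w.r.t. $(\eta_0,\eta_1)$ for both) if existence of an $(\alpha,\beta,\gamma)$-competitive algorithm for $Q$ implies existence of an $(\alpha,\beta,\gamma)$-competitive algorithm for $P$. $\mathrm{ASG}_t$: each request $r_i$ prompts an output bit $y_i$ with $\hat x_i$ revealed, $x$ revealed at the end; cost $\sum_i(y_i+t\,x_i(1-y_i))$ for $t\in\mathbb{Z}^+$; for $t=\infty$ cost $\sum_i y_i$ if no $i$ has $x_i=1,y_i=0$, else $\infty$. $\mathcal{C}_t^{(\eta_0,\eta_1)}$ ($t\in\mathbb{Z}^+\cup\{\infty\}$) is the set of online minimization problems with predictions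 $P$ such that $\mathrm{ASG}_t$ is as hard as $P$ w.r.t. $(\eta_0,\eta_1)$. *)

theory Defs
  imports Complex_Main "HOL-Library.Extended_Nat" "HOL-Library.Extended_Real"
begin

text \<open>
  A class of online problems is a set and so needs common types of requests and answers.
  The types below extend arbitrary types \<open>'r\<close> and \<open>'a\<close> by what string guessing needs: a
  request without content and answers that are bits.
\<close>

datatype 'r request = Prompt | Request 'r

datatype 'a answer = Bit (the_bit: bool) | Answer 'a

text \<open>An instance is a triple of the true bits \<open>x\<close>, the predicted bits and the requests.\<close>

type_synonym 'r problem_instance = "bool list \<times> bool list \<times> 'r list"

text \<open>
  \<open>inputs\<close> holds the pairs of true bits and requests; the predictions are arbitrary.
  The cost may depend on \<open>x\<close>, which in string guessing is revealed only at the end, but not on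
  the predictions. Infeasible answer sequences have cost \<open>\<infinity>\<close>. The solution encoded by \<open>x\<close> on
  the requests \<open>r\<close> is \<open>decode x r\<close>.
\<close>

record ('r, 'a) problem =
  inputs :: "(bool list \<times> 'r list) set"
  answers :: "'a set"
  cost :: "bool list \<Rightarrow> 'r list \<Rightarrow> 'a list \<Rightarrow> ereal"
  decode :: "bool list \<Rightarrow> 'r list \<Rightarrow> 'a list"

definition instances :: "('r, 'a) problem \<Rightarrow> 'r problem_instance set" where
  "instances P = {(x, xh, r). (x, r) \<in> inputs P \<and> length xh = length r}"

definition solutions :: "('r, 'a) problem \<Rightarrow> 'r list \<Rightarrow> 'a list set" where
  "solutions P r = {y. length y = length r \<and> set y \<subseteq> answers P}"

definition Opt :: "('r, 'a) problem \<Rightarrow> 'r problem_instance \<Rightarrow> ereal" where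
  "Opt P = (\<lambda>(x, xh, r). INF y \<in> solutions P r. cost P x r y)"

definition online_minimization_problem :: "('r, 'a) problem \<Rightarrow> bool" where
  "online_minimization_problem P \<longleftrightarrow>
     (\<forall>(x, r) \<in> inputs P. length x = length r \<and> (\<forall>y \<in> solutions P r. 0 \<le> cost P x r y)) \<and>
     (\<forall>(x, xh, r) \<in> instances P.
        decode P x r \<in> solutions P r \<and>
        cost P x r (decode P x r) = Opt P (x, xh, r) \<and> Opt P (x, xh, r) < \<infinity>)"

text \<open>
  A deterministic algorithm maps the requests seen so far, each paired with its prediction, to
  the answer to the last of them. Its earlier answers are determined by the same data.
\<close>

type_synonym ('r, 'a) algorithm = "('r \<times> bool) list \<Rightarrow> 'a"

definition alg_output :: "('r, 'a) algorithm \<Rightarrow> 'r problem_instance \<Rightarrow> 'a list" where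
  "alg_output A = (\<lambda>(x, xh, r). map (\<lambda>i. A (take (Suc i) (zip r xh))) [0..<length r])"

definition online_algorithm :: "('r, 'a) problem \<Rightarrow> ('r, 'a) algorithm \<Rightarrow> bool" where
  "online_algorithm P A \<longleftrightarrow> (\<forall>I \<in> instances P. set (alg_output A I) \<subseteq> answers P)"

definition alg_cost :: "('r, 'a) problem \<Rightarrow> ('r, 'a) algorithm \<Rightarrow> 'r problem_instance \<Rightarrow> ereal" where
  "alg_cost P A = (\<lambda>(x, xh, r). cost P x r (alg_output A (x, xh, r)))"

type_synonym 'r error_function = "'r problem_instance \<Rightarrow> real"

definition error_measure :: "'r error_function \<Rightarrow> bool" where
  "error_measure \<eta> \<longleftrightarrow>
     (\<forall>x xh r. length x = length r \<and> length xh = length r \<longrightarrow> 0 \<le> \<eta> (x, xh, r))"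

definition competitive ::
  "'r error_function \<Rightarrow> 'r error_function \<Rightarrow> real \<Rightarrow> real \<Rightarrow> real \<Rightarrow>
   ('r, 'a) problem \<Rightarrow> ('r, 'a) algorithm \<Rightarrow> bool" where
  "competitive \<eta>0 \<eta>1 \<alpha> \<beta> \<gamma> P A \<longleftrightarrow>
     (\<exists>\<kappa>::real. \<forall>I \<in> instances P.
        alg_cost P A I \<le> ereal \<alpha> * Opt P I + ereal (\<beta> * \<eta>0 I) + ereal (\<gamma> * \<eta>1 I) + ereal \<kappa>)"

definition as_hard_as ::
  "'r error_function \<Rightarrow> 'r error_function \<Rightarrow> ('r, 'a) problem \<Rightarrow> ('r, 'a) problem \<Rightarrow> bool" where
  "as_hard_as \<eta>0 \<eta>1 Q P \<longleftrightarrow>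
     (\<forall>\<alpha> \<beta> \<gamma>. 0 \<le> \<alpha> \<longrightarrow> 0 \<le> \<beta> \<longrightarrow> 0 \<le> \<gamma> \<longrightarrow>
        (\<exists>A. online_algorithm Q A \<and> competitive \<eta>0 \<eta>1 \<alpha> \<beta> \<gamma> Q A) \<longrightarrow>
        (\<exists>A. online_algorithm P A \<and> competitive \<eta>0 \<eta>1 \<alpha> \<beta> \<gamma> P A))"

definition ASG_cost :: "enat \<Rightarrow> bool list \<Rightarrow> bool list \<Rightarrow> ereal" where
  "ASG_cost t x y =
     (case t of
        enat k \<Rightarrow>
          ereal (\<Sum>i<length x. of_bool (y ! i) + real k * of_bool (x ! i) * (1 - of_bool (y ! i)))
      | \<infinity> \<Rightarrow>
          if \<exists>i<length x. x ! i \<and> \<not> y ! i then \<infinity>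
          else ereal (\<Sum>i<length x. of_bool (y ! i)))"

definition ASG :: "enat \<Rightarrow> ('r request, 'a answer) problem" where
  "ASG t =
     \<lparr>inputs = {(x, r). r = replicate (length x) Prompt},
      answers = range Bit,
      cost = (\<lambda>x r y. ASG_cost t x (map the_bit y)),
      decode = (\<lambda>x r. map Bit x)\<rparr>"

definition complexity_class ::
  "'r request error_function \<Rightarrow> 'r request error_function \<Rightarrow> enat \<Rightarrow>
   ('r request, 'a answer) problem set" where
  "complexity_class \<eta>0 \<eta>1 t =
     {P. online_minimization_problem P \<and> as_hard_as \<eta>0 \<eta>1 (ASG t) P}"

end

theory Submission
  imports Defs
begin

text \<open>
  Raising \<open>t\<close> raises the cost of every output of \<open>ASG\<^sub>t\<close> and leaves the optimum, the
  number of true ones, unchanged; hence the classes increase. For \<open>s < t\<close> the problem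
  \<open>ASG\<^sub>t\<close> itself separates them at the parameters \<open>(s, 0, 0)\<close>, which make the error measures
  irrelevant: always answering 0 achieves them on \<open>ASG\<^sub>s\<close>. On \<open>ASG\<^sub>t\<close> the adversary takes as
  true string the complement of the output. Then each round costs at least 1 more than
  \<open>s\<close> times its optimum, which exceeds any additive constant.
\<close>

text \<open>These rules rewrite sums of \<open>of_bool\<close> into cardinalities or restricted
  sums; the arguments below compare such sums term by term.\<close>

declare sum_of_bool_eq [simp del] sum_mult_of_bool_eq [simp del] sum_of_bool_mult_eq [simp del]

lemma ASG_cost_mono:
  assumes "s \<le> t"
  shows "ASG_cost s x y \<le> ASG_cost t x y"
proof (cases s)
  case (enat k)
  show ?thesis
  proof (cases t)
    case (enat m)
    with \<open>s = enat k\<close> assms show ?thesis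
      by (auto simp: ASG_cost_def intro!: sum_mono mult_right_mono)
  next
    \<comment> \<open>Either a true bit is missed and the right side is infinite, or every penalty
      term on the left vanishes.\<close>
    case infinity
    with \<open>s = enat k\<close> show ?thesis
      by (auto simp: ASG_cost_def intro!: sum_mono)
  qed
next
  case infinity
  with assms show ?thesis by simp
qed

lemma ASG_cost_true_bits: "ASG_cost t x x = ereal (\<Sum>i<length x. of_bool (x ! i))"
  by (cases t) (auto simp: ASG_cost_def intro!: sum.cong)

text \<open>A round with a true bit costs at least 1, whether the bit is answered or missed. For
  \<open>t = 1\<close> this is a termwise comparison, and monotonicity in \<open>t\<close> gives the
  rest.\<close>

lemma ASG_cost_ge_true_bits:
  assumes "1 \<le> t"
  shows "ereal (\<Sum>i<length x. of_bool (x ! i)) \<le> ASG_cost t x y"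
proof -
  have "ereal (\<Sum>i<length x. of_bool (x ! i)) \<le> ASG_cost 1 x y"
    by (auto simp: ASG_cost_def one_enat_def intro!: sum_mono)
  also have "\<dots> \<le> ASG_cost t x y"
    using assms by (rule ASG_cost_mono)
  finally show ?thesis .
qed

lemma instances_ASG:
  "instances (ASG t) = {(x, xh, r). r = replicate (length x) Prompt \<and> length xh = length x}"
  by (auto simp: instances_def ASG_def)

text \<open>The output \<open>x\<close> attains the lower bound. For \<open>t = 0\<close> the
  formula fails, because missed bits are then free.\<close>

lemma Opt_ASG:
  assumes "1 \<le> t" and "length r = length x"
  shows "Opt (ASG t) (x, xh, r) = ereal (\<Sum>i<length x. of_bool (x ! i))"
proof -
  have "map Bit x \<in> solutions (ASG t) r"
    using assms(2) by (auto simp: solutions_def ASG_def)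
  moreover have "cost (ASG t) x r (map Bit x) = ereal (\<Sum>i<length x. of_bool (x ! i))"
    by (simp add: ASG_def ASG_cost_true_bits comp_def)
  moreover have "ereal (\<Sum>i<length x. of_bool (x ! i)) \<le> cost (ASG t) x r y" for y
    using ASG_cost_ge_true_bits[OF assms(1)] by (simp add: ASG_def)
  ultimately show ?thesis
    unfolding Opt_def by (auto intro!: antisym INF_greatest INF_lower2 simp: order.eq_iff)
qed

lemma online_minimization_problem_ASG:
  assumes "1 \<le> t"
  shows "online_minimization_problem (ASG t :: ('r request, 'a answer) problem)"
proof -
  have "0 \<le> cost (ASG t) x r y"
    for x and r :: "'r request list" and y :: "'a answer list"
  proof -
    have "0 \<le> ereal (\<Sum>i<length x. of_bool (x ! i))"
      by (simp add: sum_nonneg)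
    also have "\<dots> \<le> cost (ASG t) x r y"
      using ASG_cost_ge_true_bits[OF assms] by (simp add: ASG_def)
    finally show ?thesis .
  qed
  moreover have "length x = length r"
    if "(x, r) \<in> inputs (ASG t :: ('r request, 'a answer) problem)" for x :: "bool list" and r :: "'r request list"
    using that by (simp add: ASG_def)
  moreover have "decode (ASG t) x r \<in> solutions (ASG t :: ('r request, 'a answer) problem) r"
    and "cost (ASG t) x r (decode (ASG t) x r) = Opt (ASG t :: ('r request, 'a answer) problem) (x, xh, r)"
    and "Opt (ASG t :: ('r request, 'a answer) problem) (x, xh, r) < \<infinity>"
    if "(x, xh, r) \<in> instances (ASG t :: ('r request, 'a answer) problem)" for x xh and r :: "'r request list"
  proof -
    from that have r: "length r = length x"
      by (simp add: instances_ASG)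
    show "decode (ASG t) x r \<in> solutions (ASG t :: ('r request, 'a answer) problem) r"
      using r by (auto simp: solutions_def ASG_def)
    show "cost (ASG t) x r (decode (ASG t) x r) = Opt (ASG t :: ('r request, 'a answer) problem) (x, xh, r)"
      by (simp add: Opt_ASG[OF assms r]) (simp add: ASG_def ASG_cost_true_bits comp_def)
    show "Opt (ASG t :: ('r request, 'a answer) problem) (x, xh, r) < \<infinity>"
      by (simp add: Opt_ASG[OF assms r])
  qed
  ultimately show ?thesis
    unfolding online_minimization_problem_def by blast
qed

lemma online_algorithm_ASG_cong: "online_algorithm (ASG s) A \<longleftrightarrow> online_algorithm (ASG t) A"
  by (simp add: online_algorithm_def instances_ASG) (simp add: ASG_def)

text \<open>The same algorithm and the same \<open>\<kappa>\<close> work: passing from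
  \<open>t\<close> to \<open>s\<close> can only lower the cost, while the right side keeps its value
  because the optimum does not depend on \<open>t\<close>.\<close>

lemma competitive_ASG_antimono:
  fixes A :: "('r request, 'a answer) algorithm"
  assumes "1 \<le> s" and "s \<le> t" and "competitive \<eta>0 \<eta>1 \<alpha> \<beta> \<gamma> (ASG t) A"
  shows "competitive \<eta>0 \<eta>1 \<alpha> \<beta> \<gamma> (ASG s) A"
proof -
  have "1 \<le> t"
    using assms(1,2) by (rule order_trans)
  from assms(3) obtain \<kappa> where \<kappa>: "alg_cost (ASG t) A I \<le>
      ereal \<alpha> * Opt (ASG t :: ('r request, 'a answer) problem) I + ereal (\<beta> * \<eta>0 I) + ereal (\<gamma> * \<eta>1 I) + ereal \<kappa>"
    if "I \<in> instances (ASG t :: ('r request, 'a answer) problem)" for I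
    unfolding competitive_def by blast
  have "alg_cost (ASG s) A I \<le>
      ereal \<alpha> * Opt (ASG s :: ('r request, 'a answer) problem) I + ereal (\<beta> * \<eta>0 I) + ereal (\<gamma> * \<eta>1 I) + ereal \<kappa>"
    if I: "I \<in> instances (ASG s :: ('r request, 'a answer) problem)" for I
  proof -
    have "alg_cost (ASG s) A I \<le> alg_cost (ASG t) A I"
      using ASG_cost_mono[OF assms(2)] by (auto simp: alg_cost_def ASG_def split: prod.split)
    also have "\<dots> \<le>
        ereal \<alpha> * Opt (ASG t :: ('r request, 'a answer) problem) I + ereal (\<beta> * \<eta>0 I) + ereal (\<gamma> * \<eta>1 I) + ereal \<kappa>"
      using I by (intro \<kappa>) (simp add: instances_ASG)
    also have "Opt (ASG t :: ('r request, 'a answer) problem) I = Opt (ASG s :: ('r request, 'a answer) problem) I"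
      using I by (auto simp: instances_ASG Opt_ASG[OF \<open>1 \<le> s\<close>] Opt_ASG[OF \<open>1 \<le> t\<close>])
    finally show ?thesis .
  qed
  then show ?thesis
    unfolding competitive_def by blast
qed

lemma as_hard_as_refl: "as_hard_as \<eta>0 \<eta>1 P P"
  by (simp add: as_hard_as_def)

lemma as_hard_as_trans:
  assumes "as_hard_as \<eta>0 \<eta>1 R Q" and "as_hard_as \<eta>0 \<eta>1 Q P"
  shows "as_hard_as \<eta>0 \<eta>1 R P"
  using assms by (simp add: as_hard_as_def)

lemma as_hard_as_ASG_mono:
  assumes "1 \<le> s" and "s \<le> t"
  shows "as_hard_as \<eta>0 \<eta>1 (ASG t) (ASG s)"
  unfolding as_hard_as_def
  using competitive_ASG_antimono[OF assms] online_algorithm_ASG_cong[of s _ t] by blast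

lemma complexity_class_mono:
  assumes "1 \<le> s" and "s \<le> t"
  shows "complexity_class \<eta>0 \<eta>1 s \<subseteq> complexity_class \<eta>0 \<eta>1 t"
  using as_hard_as_trans[OF as_hard_as_ASG_mono[OF assms]]
  unfolding complexity_class_def by blast

lemma all_zero_online_algorithm: "online_algorithm (ASG t) (\<lambda>_. Bit False)"
  by (auto simp: online_algorithm_def alg_output_def ASG_def)

text \<open>Each true bit is missed at cost \<open>k\<close> and no other cost arises, so the bound
  holds with equality and \<open>\<kappa> = 0\<close>.\<close>

lemma all_zero_competitive:
  assumes "1 \<le> k"
  shows "competitive \<eta>0 \<eta>1 (real k) 0 0
    (ASG (enat k) :: ('r request, 'a answer) problem) (\<lambda>_. Bit False)"
proof -
  have k: "1 \<le> enat k"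
    using assms by (simp add: one_enat_def)
  have "alg_cost (ASG (enat k) :: ('r request, 'a answer) problem) (\<lambda>_. Bit False) (x, xh, r) =
      ereal (real k) * Opt (ASG (enat k) :: ('r request, 'a answer) problem) (x, xh, r)"
    if "length r = length x" for x xh and r :: "'r request list"
    by (simp add: Opt_ASG[OF k that])
      (simp add: alg_cost_def alg_output_def ASG_def ASG_cost_def that sum_distrib_left)
  then show ?thesis
    unfolding competitive_def by (auto simp: instances_ASG intro!: exI[of _ 0])
qed

text \<open>With penalty \<open>k + 1\<close>, a missed true bit costs \<open>k + 1\<close> and a
  needless 1 costs 1; both equal \<open>k * x_i + 1\<close>.\<close>

lemma ASG_cost_complement_ge:
  assumes "enat k < t"
  shows "ereal (real k * (\<Sum>i<length x. of_bool (x ! i)) + length x) \<le> ASG_cost t x (map Not x)"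
proof -
  \<comment> \<open>Integrality provides the extra 1 on true bits; \<open>t = \<infinity>\<close> is
    covered as well.\<close>
  have "enat (Suc k) \<le> t"
    using assms by (cases t) auto
  then have "ASG_cost (enat (Suc k)) x (map Not x) \<le> ASG_cost t x (map Not x)"
    by (rule ASG_cost_mono)
  moreover have "ASG_cost (enat (Suc k)) x (map Not x) =
      ereal (\<Sum>i<length x. real k * of_bool (x ! i) + 1)"
    by (auto simp: ASG_cost_def intro!: sum.cong)
  ultimately show ?thesis
    by (simp add: sum.distrib sum_distrib_left)
qed

lemma not_competitive_ASG:
  fixes A :: "('r request, 'a answer) algorithm"
  assumes "1 \<le> k" and "enat k < t"
  shows "\<not> competitive \<eta>0 \<eta>1 (real k) 0 0 (ASG t) A"
proof
  assume "competitive \<eta>0 \<eta>1 (real k) 0 0 (ASG t) A"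
  then obtain \<kappa> where \<kappa>: "alg_cost (ASG t) A I \<le> ereal (real k) * Opt (ASG t :: ('r request, 'a answer) problem) I + ereal \<kappa>"
    if "I \<in> instances (ASG t :: ('r request, 'a answer) problem)" for I
    unfolding competitive_def by (simp add: zero_ereal_def[symmetric]) blast
  have "1 \<le> enat k"
    using assms(1) by (simp add: one_enat_def)
  then have t: "1 \<le> t"
    using assms(2) by order
  \<comment> \<open>The excess over \<open>k\<close> times the optimum is at least 1 per round, so
    \<open>n\<close> rounds exceed \<open>\<kappa>\<close>.\<close>
  obtain n :: nat where n: "\<kappa> < real n"
    using reals_Archimedean2 by blast
  define r :: "'r request list" where "r = replicate n Prompt"
  \<comment> \<open>Any predictions fixed before \<open>x\<close> would do: both errors have
    coefficient 0, so bad predictions do not loosen the bound.\<close>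
  define xh where "xh = replicate n False"
  \<comment> \<open>The output does not depend on the true bits, so they can be chosen after it.\<close>
  define x where "x = map (Not \<circ> the_bit) (alg_output A ([], xh, r))"
  have len: "length x = n"
    by (simp add: x_def alg_output_def r_def)
  have out: "map the_bit (alg_output A (x, xh, r)) = map Not x"
    by (simp add: x_def alg_output_def)
  have "(x, xh, r) \<in> instances (ASG t :: ('r request, 'a answer) problem)"
    by (simp add: instances_ASG len r_def xh_def)
  from \<kappa>[OF this] have "alg_cost (ASG t) A (x, xh, r) \<le>
      ereal (real k * (\<Sum>i<length x. of_bool (x ! i)) + \<kappa>)"
    using len by (simp add: Opt_ASG[OF t] r_def)
  moreover have "alg_cost (ASG t) A (x, xh, r) = ASG_cost t x (map Not x)"
    by (simp add: alg_cost_def ASG_def out)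
  ultimately have "ASG_cost t x (map Not x) \<le>
      ereal (real k * (\<Sum>i<length x. of_bool (x ! i)) + \<kappa>)"
    by simp
  with ASG_cost_complement_ge[OF assms(2), of x]
  have "ereal (real k * (\<Sum>i<length x. of_bool (x ! i)) + length x) \<le>
      ereal (real k * (\<Sum>i<length x. of_bool (x ! i)) + \<kappa>)"
    by (rule order_trans)
  then show False
    using n len by simp
qed

text \<open>Letting \<open>t\<close> range over \<open>enat\<close> treats the successor
  \<open>k + 1\<close> and the top class \<open>\<infinity>\<close> at once.\<close>

lemma complexity_class_strict_mono:
  assumes "1 \<le> k" and "enat k < t"
  shows "(complexity_class \<eta>0 \<eta>1 (enat k) :: ('r request, 'a answer) problem set)
    \<subset> complexity_class \<eta>0 \<eta>1 t"
proof -
  have k: "1 \<le> enat k"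
    using assms(1) by (simp add: one_enat_def)
  then have t: "1 \<le> t"
    using assms(2) by order
  have "(ASG t :: ('r request, 'a answer) problem) \<in> complexity_class \<eta>0 \<eta>1 t"
    by (simp add: complexity_class_def online_minimization_problem_ASG[OF t] as_hard_as_refl)
  moreover have "\<not> as_hard_as \<eta>0 \<eta>1 (ASG (enat k)) (ASG t :: ('r request, 'a answer) problem)"
  proof
    assume "as_hard_as \<eta>0 \<eta>1 (ASG (enat k)) (ASG t :: ('r request, 'a answer) problem)"
    then have "\<exists>A. online_algorithm (ASG t :: ('r request, 'a answer) problem) A \<and>
        competitive \<eta>0 \<eta>1 (real k) 0 0 (ASG t) A"
      unfolding as_hard_as_def
      using all_zero_online_algorithm all_zero_competitive[OF assms(1)]
      by (meson of_nat_0_le_iff order_refl)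
    then show False
      using not_competitive_ASG[OF assms] by blast
  qed
  then have "(ASG t :: ('r request, 'a answer) problem) \<notin> complexity_class \<eta>0 \<eta>1 (enat k)"
    by (simp add: complexity_class_def)
  ultimately show ?thesis
    using complexity_class_mono[OF k order_less_imp_le[OF assms(2)]] by blast
qed

theorem theorem29:
  fixes \<eta>0 \<eta>1 :: "'r request error_function"
  assumes "error_measure \<eta>0" and "error_measure \<eta>1"
  shows "(\<forall>t::nat. 1 \<le> t \<longrightarrow>
            (complexity_class \<eta>0 \<eta>1 (enat t) :: ('r request, 'a answer) problem set)
              \<subset> complexity_class \<eta>0 \<eta>1 (enat (t + 1))) \<and>
         (\<forall>t::nat. 1 \<le> t \<longrightarrow>
            (complexity_class \<eta>0 \<eta>1 (enat t) :: ('r request, 'a answer) problem set)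
              \<subset> complexity_class \<eta>0 \<eta>1 \<infinity>)"
  by (intro conjI allI impI complexity_class_strict_mono) simp_all

end
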